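(* Let $n\ge 2$, and let $E\subset\mathbb{R}^n$ be a compact $Q$-regular set with $0<Q<n$ such that $G=\mathbb{R}^n\setminus E$ is a $\psi$-uniform domain. Then for each $x\in G$ there exist $c>0$ and $r_1>0$ such that $$\mathrm{vol}_k(B_k(x,r))\ \ge\ c\,(\psi^{-1}(r))^Q\qquad\text{for all } r>r_1,$$ where $c$ and $r_1$ depend only on the $Q$-regularity data of $E$ and on $d(x)$.
   Context: For a proper subdomain $G\subset\mathbb{R}^n$ write $d(z)=d(z,\partial G)$ for the Euclidean distance from $z\in G$ to $\partial G$. The quasihyperbolic distance is $k_G(x,y)=\inf_{\alpha}\int_\alpha \frac{|dz|}{d(z)}$, the infimum being over all rectifiable curves $\alpha$ in $G$ joining $x$ and $y$. The quasihyperbolic ball is $B_k(x,r)=\{z\in G: k_G(x,z)<r\}$. The quasihyperbolic volume of a Lebesgue measurable set $A\subset G$ is $\mathrm{vol}_k(A)=\int_A \frac{dm(z)}{d(z)^n}$, where $m$ is $n$-dimensional Lebesgue measure. A set $E\subset\mathbb{R}^n$ is $Q$-regular ($0<Q<n$) if there is a (Borel regular, outer) measure $\mu$ with $\operatorname{spt}(\mu)=E$ (the smallest closed set of full $\mu$-measure) and constants $0<\alpha\le\beta<\infty$ such that $\alpha r^Q\le\mu(B^n(x,r))\le\beta r^Q$ for all $x\in E$ and $0<r<\operatorname{diam}(E)$, where $B^n(x,r)$ is the open Euclidean ball. The $Q$-regularity data are $n,Q,\alpha,\beta$ and $\operatorname{diam}(E)$. Let $\psi:[0,\infty)\to[0,\infty)$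 be a homeomorphism with $\psi(0)=0$. A domain $G\subset\mathbb{R}^n$ is $\psi$-uniform if $k_G(x,y)\le\psi\big(|x-y|/\min\{d(x,\partial G),d(y,\partial G)\}\big)$ for all $x,y\in G$.
   Formalization: The formal theorem assumes diam(E) > 0; a one-point set is vacuously Q-regular under the stated definition, and the claim fails for it (exponential ψ^{-1}, linear volume growth). *)

theory Defs
  imports "HOL-Analysis.Analysis"
begin

subsection \<open>Rectifiable curves and integration with respect to arc length\<close>

definition curve_length :: "(real \<Rightarrow> 'a::metric_space) \<Rightarrow> real \<Rightarrow> real \<Rightarrow> ennreal" where
  "curve_length g a b =
     (SUP ts \<in> {ts. sorted ts \<and> set ts \<subseteq> {a..b}}.
        \<Sum>i < length ts - 1. ennreal (dist (g (ts ! i)) (g (ts ! Suc i))))"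

definition rectifiable_path :: "(real \<Rightarrow> 'a::metric_space) \<Rightarrow> bool" where
  "rectifiable_path g \<longleftrightarrow> path g \<and> curve_length g 0 1 < \<infinity>"

text \<open>The parametrization by arc length sends u to the common value of g at all times t at which
  the initial arc of g up to t has length u; g is constant on the set of these t, so the
  choice does not matter.\<close>

definition arclength_param :: "(real \<Rightarrow> 'a::metric_space) \<Rightarrow> real \<Rightarrow> 'a" where
  "arclength_param g u = g (SOME t. t \<in> {0..1} \<and> curve_length g 0 t = ennreal u)"

definition arclength_integral :: "(real \<Rightarrow> 'a::metric_space) \<Rightarrow> ('a \<Rightarrow> real) \<Rightarrow> ennreal" where
  "arclength_integral g f =
     (\<integral>\<^sup>+ u \<in> {0..enn2real (curve_length g 0 1)}. ennreal (f (arclength_param g u)) \<partial>lborel)"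

subsection \<open>Quasihyperbolic geometry\<close>

definition proper_subdomain :: "'a::topological_space set \<Rightarrow> bool" where
  "proper_subdomain G \<longleftrightarrow> open G \<and> connected G \<and> G \<noteq> {} \<and> G \<noteq> UNIV"

definition bdist :: "'a::metric_space set \<Rightarrow> 'a \<Rightarrow> real" where
  "bdist G z = infdist z (frontier G)"

definition qh_dist :: "'a::metric_space set \<Rightarrow> 'a \<Rightarrow> 'a \<Rightarrow> ennreal" where
  "qh_dist G x y =
     (INF g \<in> {g. rectifiable_path g \<and> path_image g \<subseteq> G \<and> pathstart g = x \<and> pathfinish g = y}.
        arclength_integral g (\<lambda>z. 1 / bdist G z))"

definition qh_ball :: "'a::metric_space set \<Rightarrow> 'a \<Rightarrow> real \<Rightarrow> 'a set" where
  "qh_ball G x r = {z \<in> G. qh_dist G x z < ennreal r}"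

definition qh_vol :: "'a::euclidean_space set \<Rightarrow> 'a set \<Rightarrow> ennreal" where
  "qh_vol G A = (\<integral>\<^sup>+ z \<in> A. ennreal (1 / bdist G z ^ DIM('a)) \<partial>lebesgue)"

text \<open>The gauge \<open>\<psi>\<close> is only meaningful on \<open>{0..}\<close>; that it is a self-homeomorphism of
  \<open>{0..}\<close> fixing 0 is stated separately.\<close>

definition psi_uniform :: "(real \<Rightarrow> real) \<Rightarrow> 'a::euclidean_space set \<Rightarrow> bool" where
  "psi_uniform \<psi> G \<longleftrightarrow> proper_subdomain G \<and>
     (\<forall>x\<in>G. \<forall>y\<in>G. qh_dist G x y \<le> ennreal (\<psi> (dist x y / min (bdist G x) (bdist G y))))"

subsection \<open>Regular sets\<close>

text \<open>Measures are outer measures defined on all subsets. Borel regular: Borel sets are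
  Caratheodory measurable (i.e. they belong to the \<open>lambda_system\<close>), and every set
  has a Borel superset of the same measure.\<close>

definition borel_regular_outer_measure :: "('a::topological_space set \<Rightarrow> ennreal) \<Rightarrow> bool" where
  "borel_regular_outer_measure \<mu> \<longleftrightarrow>
     outer_measure_space UNIV \<mu> \<and>
     sets borel \<subseteq> lambda_system UNIV UNIV \<mu> \<and>
     (\<forall>A. \<exists>B\<in>sets borel. A \<subseteq> B \<and> \<mu> B = \<mu> A)"

definition measure_support :: "('a::topological_space set \<Rightarrow> ennreal) \<Rightarrow> 'a set \<Rightarrow> bool" where
  "measure_support \<mu> E \<longleftrightarrow>
     closed E \<and> \<mu> (- E) = 0 \<and> (\<forall>F. closed F \<and> \<mu> (- F) = 0 \<longrightarrow> E \<subseteq> F)"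

text \<open>\<open>diameter\<close> is meaningful only for bounded sets; an unbounded set has infinite diameter and
  the radius is then unrestricted. For a one-point set the condition on balls is vacuous, so
  results about regular sets need \<open>0 < diameter E\<close>.\<close>

definition Q_regular :: "real \<Rightarrow> real \<Rightarrow> real \<Rightarrow> 'a::euclidean_space set \<Rightarrow> bool" where
  "Q_regular Q \<alpha> \<beta> E \<longleftrightarrow>
     0 < Q \<and> Q < real DIM('a) \<and> 0 < \<alpha> \<and> \<alpha> \<le> \<beta> \<and>
     (\<exists>\<mu>. borel_regular_outer_measure \<mu> \<and> measure_support \<mu> E \<and>
        (\<forall>x\<in>E. \<forall>r. 0 < r \<and> (bounded E \<longrightarrow> r < diameter E) \<longrightarrow>
           ennreal (\<alpha> * r powr Q) \<le> \<mu> (ball x r) \<and> \<mu> (ball x r) \<le> ennreal (\<beta> * r powr Q)))"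

end

theory Submission
  imports Defs
begin

text \<open>Since \<open>Q < n\<close>, regularity makes \<open>E\<close> porous: around each point of \<open>E\<close>, at every small scale
  \<open>s\<close>, there is a ball of radius \<open>s\<close> at distance comparable to \<open>s\<close> from \<open>E\<close>. A maximal separated
  subset of \<open>E\<close> at scale \<open>s\<close> has at least a constant times \<open>s^(-Q)\<close> points, so the layer of points
  at distance comparable to \<open>s\<close> from \<open>E\<close> has quasihyperbolic volume at least a constant times
  \<open>s^(-Q)\<close>. Uniformity puts this layer into the quasihyperbolic ball of radius \<open>r\<close> about \<open>x\<close> as
  soon as \<open>s\<close> is comparable to \<open>1 / \<psi>inv r\<close>. If \<open>\<psi>inv r\<close> is too small for this, the Euclidean ball
  of radius \<open>d(x) / 2\<close> about \<open>x\<close> already has enough volume, which is why the constants do not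
  depend on \<open>\<psi>\<close>.\<close>

section \<open>Separated nets and disjoint balls\<close>

text \<open>A separated subset of maximal cardinality covers \<open>A\<close>, since an uncovered
  point could be added to it. The maximum exists because each ball of radius \<open>\<rho>/2\<close>
  in a finite cover holds at most one point of a separated set.\<close>

lemma compact_separated_net:
  fixes A :: "'a::metric_space set"
  assumes "compact A" "0 < \<rho>"
  obtains S where "finite S" "S \<subseteq> A"
    "pairwise (\<lambda>x y. \<rho> \<le> dist x y) S" "A \<subseteq> (\<Union>x\<in>S. ball x \<rho>)"
proof -
  define sep where
    "sep S \<longleftrightarrow> finite S \<and> S \<subseteq> A \<and> pairwise (\<lambda>x y. \<rho> \<le> dist x y) S" for S
  obtain K where K: "finite K" "A \<subseteq> (\<Union>x\<in>K. ball x (\<rho>/2))"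
    using compactE_image[OF assms(1), of A "\<lambda>x. ball x (\<rho>/2)"] assms(2)
    by (metis UN_I centre_in_ball half_gt_zero open_ball subsetI)
  have card_le: "card S \<le> card K" if "sep S" for S
  proof -
    have "\<forall>x\<in>S. \<exists>k\<in>K. dist k x < \<rho>/2"
      using K(2) that by (fastforce simp: sep_def)
    then obtain f where f: "\<And>x. x \<in> S \<Longrightarrow> f x \<in> K \<and> dist (f x) x < \<rho>/2" by metis
    have "inj_on f S"
    proof (rule inj_onI, rule ccontr)
      fix x y assume xy: "x \<in> S" "y \<in> S" "f x = f y" "x \<noteq> y"
      then have "dist x y < \<rho>" using f[of x] f[of y] by (metis dist_triangle_half_r)
      then show False using xy that by (force simp: sep_def pairwise_def)
    qed
    moreover have "f ` S \<subseteq> K" using f by blast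
    ultimately show ?thesis using card_inj_on_le K(1) by blast
  qed
  have "sep {}" by (simp add: sep_def)
  then obtain S where S: "sep S" and max: "\<And>T. sep T \<Longrightarrow> card T \<le> card S"
    using ex_has_greatest_nat[of sep "{}" card "Suc (card K)"] card_le by (metis less_Suc_eq_le)
  have "A \<subseteq> (\<Union>x\<in>S. ball x \<rho>)"
  proof (rule ccontr)
    assume "\<not> ?thesis"
    then obtain a where a: "a \<in> A" "\<And>x. x \<in> S \<Longrightarrow> \<rho> \<le> dist x a" by force
    then have "sep (insert a S)" using S by (auto simp: sep_def pairwise_insert dist_commute)
    moreover have "a \<notin> S" using a(2)[of a] assms(2) by auto
    ultimately show False using max[of "insert a S"] S by (simp add: sep_def)
  qed
  then show ?thesis using that S by (auto simp: sep_def)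
qed

lemma disjoint_family_on_separated_balls:
  assumes "pairwise (\<lambda>x y. 2 * \<rho> \<le> dist x y) S"
  shows "disjoint_family_on (\<lambda>x. ball x \<rho>) S"
  unfolding disjoint_family_on_def
proof (intro ballI impI equals0I)
  fix x y z assume *: "x \<in> S" "y \<in> S" "x \<noteq> y" "z \<in> ball x \<rho> \<inter> ball y \<rho>"
  then show False using pairwiseD[OF assms, of x y] dist_triangle2[of x y z] by simp
qed

section \<open>Boundary distance, segments and volume estimates\<close>

text \<open>The segment from \<open>z\<close> to a nearest point of \<open>E\<close> meets the
  frontier, so the frontier is no farther away than \<open>E\<close>; conversely, the frontier of a
  closed set lies in the set.\<close>

lemma bdist_Compl_eq_infdist:
  fixes E :: "'a::euclidean_space set"
  assumes "closed E" "E \<noteq> {}" "z \<notin> E"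
  shows "bdist (- E) z = infdist z E"
proof -
  obtain e where e: "e \<in> E" "infdist z E = dist z e"
    using infdist_attains_inf[OF assms(1,2)] by blast
  have "closed_segment z e \<inter> frontier E \<noteq> {}"
    using e assms(3) by (intro connected_Int_frontier) auto
  then obtain p where p: "p \<in> closed_segment z e" "p \<in> frontier E" by blast
  have "infdist z (frontier E) \<le> dist z e"
    using infdist_le[OF p(2), of z] dist_in_closed_segment[OF p(1)] by (simp add: dist_commute)
  moreover have "infdist z E \<le> infdist z (frontier E)"
    using p(2) frontier_subset_closed[OF assms(1)] by (intro infdist_mono) auto
  ultimately show ?thesis using e by (simp add: bdist_def frontier_complement)
qed

text \<open>Along a segment, distances between consecutive times add up exactly: partition sums
  telescope, and the partition \<open>[0,t]\<close> attains the supremum.\<close>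

lemma curve_length_linepath:
  fixes x y :: "'a::real_normed_vector"
  assumes "0 \<le> t" "t \<le> 1"
  shows "curve_length (linepath x y) 0 t = ennreal (t * dist x y)"
proof -
  have d: "dist (linepath x y u) (linepath x y v) = (v - u) * dist x y" if "u \<le> v" for u v
  proof -
    have "linepath x y u - linepath x y v = (v - u) *\<^sub>R (x - y)"
      by (simp add: linepath_def algebra_simps)
    then show ?thesis using that by (simp add: dist_norm)
  qed
  have telescope: "(\<Sum>i < length ts - 1. ennreal (dist (linepath x y (ts ! i)) (linepath x y (ts ! Suc i))))
      \<le> ennreal (t * dist x y)" if ts: "sorted ts" "set ts \<subseteq> {0..t}" for ts
  proof (cases "ts = []")
    case False
    have "(\<Sum>i < length ts - 1. ennreal (dist (linepath x y (ts ! i)) (linepath x y (ts ! Suc i))))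
        = ennreal (\<Sum>i < length ts - 1. (ts ! Suc i - ts ! i) * dist x y)"
      using ts by (subst sum_ennreal[symmetric]) (auto simp: d sorted_nth_mono intro!: sum.cong)
    also have "(\<Sum>i < length ts - 1. (ts ! Suc i - ts ! i) * dist x y)
        = (ts ! (length ts - 1) - ts ! 0) * dist x y"
      by (simp add: sum_distrib_right[symmetric] sum_lessThan_telescope)
    also have "\<dots> \<le> t * dist x y"
    proof (intro mult_right_mono)
      have "ts ! 0 \<in> set ts" "ts ! (length ts - 1) \<in> set ts" using False by auto
      then have "0 \<le> ts ! 0" "ts ! (length ts - 1) \<le> t" using ts(2) by auto
      then show "ts ! (length ts - 1) - ts ! 0 \<le> t" by linarith
    qed simp
    finally show ?thesis using ennreal_leI by metis
  qed simp
  show ?thesis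
  proof (rule antisym)
    show "curve_length (linepath x y) 0 t \<le> ennreal (t * dist x y)"
      unfolding curve_length_def using telescope by (intro SUP_least) blast
    have "ennreal (t * dist x y) = (\<Sum>i < length [0,t] - 1.
        ennreal (dist (linepath x y ([0,t] ! i)) (linepath x y ([0,t] ! Suc i))))"
      using assms d[of 0 t] by simp
    also have "\<dots> \<le> curve_length (linepath x y) 0 t"
      unfolding curve_length_def by (intro SUP_upper) (use assms in auto)
    finally show "ennreal (t * dist x y) \<le> curve_length (linepath x y) 0 t" .
  qed
qed

text \<open>The segment is one competitor in the infimum, and the density along it is at most
  \<open>1 / m\<close>.\<close>

lemma qh_dist_le_segment:
  fixes G :: "'a::euclidean_space set"
  assumes "closed_segment x y \<subseteq> G" "0 < m"
    and m: "\<And>z. z \<in> closed_segment x y \<Longrightarrow> m \<le> bdist G z"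
  shows "qh_dist G x y \<le> ennreal (dist x y / m)"
proof -
  let ?g = "linepath x y"
  have len: "curve_length ?g 0 1 = ennreal (dist x y)"
    using curve_length_linepath[of 1 x y] by simp
  have "qh_dist G x y \<le> arclength_integral ?g (\<lambda>z. 1 / bdist G z)"
    unfolding qh_dist_def using assms(1) len
    by (intro INF_lower) (auto simp: rectifiable_path_def)
  also have "\<dots> \<le> (\<integral>\<^sup>+ u. ennreal (1 / m) * indicator {0..dist x y} u \<partial>lborel)"
    unfolding arclength_integral_def len enn2real_ennreal[OF zero_le_dist]
  proof (intro nn_integral_mono)
    fix u
    show "ennreal (1 / bdist G (arclength_param ?g u)) * indicator {0..dist x y} u
        \<le> ennreal (1 / m) * indicator {0..dist x y} u"
    proof (cases "u \<in> {0..dist x y}")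
      case True
      \<comment> \<open>The choice in \<open>arclength_param\<close> is controlled only if a time
        with arc length \<open>u\<close> exists: \<open>u / dist x y\<close>, or \<open>0\<close>
        for a degenerate segment.\<close>
      have "\<exists>t. t \<in> {0..1} \<and> curve_length ?g 0 t = ennreal u"
      proof (cases "x = y")
        case False
        then show ?thesis using True
          by (intro exI[of _ "u / dist x y"]) (auto simp: curve_length_linepath)
      qed (use True in \<open>auto simp: curve_length_linepath intro: exI[of _ 0]\<close>)
      from someI_ex[OF this]
      have "(SOME t. t \<in> {0..1} \<and> curve_length ?g 0 t = ennreal u) \<in> {0..1}" ..
      then have "arclength_param ?g u \<in> closed_segment x y"
        unfolding arclength_param_def by (simp add: linepath_in_path)
      from m[OF this] assms(2) show ?thesis
        by (intro mult_right_mono ennreal_leI divide_left_mono) auto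
    qed simp
  qed
  also have "\<dots> = ennreal (dist x y / m)"
    using assms(2) by (simp add: nn_integral_cmult_indicator ennreal_mult'[symmetric])
  finally show ?thesis .
qed

text \<open>The density is at least \<open>1 / \<rho> ^ DIM('a)\<close> on the Borel set
  \<open>B\<close>; the set \<open>A\<close>, later a quasihyperbolic ball, enters only through
  inclusion.\<close>

lemma qh_vol_ge:
  fixes G :: "'a::euclidean_space set"
  assumes "B \<in> sets borel" "B \<subseteq> A" "\<And>z. z \<in> B \<Longrightarrow> 0 < bdist G z \<and> bdist G z \<le> \<rho>"
  shows "ennreal (1 / \<rho> ^ DIM('a)) * emeasure lborel B \<le> qh_vol G A"
proof -
  have "ennreal (1 / \<rho> ^ DIM('a)) * emeasure lborel B
      = (\<integral>\<^sup>+ z. ennreal (1 / \<rho> ^ DIM('a)) * indicator B z \<partial>lebesgue)"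
    using assms(1) by (subst nn_integral_cmult_indicator) auto
  also have "\<dots> \<le> qh_vol G A"
    unfolding qh_vol_def
  proof (intro nn_integral_mono)
    fix z
    show "ennreal (1 / \<rho> ^ DIM('a)) * indicator B z
        \<le> ennreal (1 / bdist G z ^ DIM('a)) * indicator A z"
    proof (cases "z \<in> B")
      case True
      then show ?thesis using assms(2) assms(3)[OF True]
        by (auto simp: subset_iff intro!: ennreal_leI divide_left_mono power_mono mult_pos_pos zero_less_power)
    qed simp
  qed
  finally show ?thesis .
qed

section \<open>Regular measures, counting and porosity\<close>

text \<open>By Caratheodory's theorem \<open>\<mu>\<close> is countably additive on its measurable
  sets, which include the Borel sets. The restriction is a genuine measure, to which the usual
  additivity lemmas apply.\<close>

lemma borel_measure_of_outer_measure:
  fixes \<mu> :: "'a::topological_space set \<Rightarrow> ennreal"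
  assumes "borel_regular_outer_measure \<mu>"
  obtains \<nu> where "sets \<nu> = sets borel" "\<And>A. A \<in> sets borel \<Longrightarrow> emeasure \<nu> A = \<mu> A"
proof -
  let ?L = "lambda_system UNIV UNIV \<mu>"
  have oms: "outer_measure_space UNIV \<mu>" and sub: "sets borel \<subseteq> ?L"
    using assms by (auto simp: borel_regular_outer_measure_def)
  interpret sigma_algebra "UNIV :: 'a set" UNIV
    using sigma_algebra_Pow[of "UNIV :: 'a set"] by simp
  have "measure_space UNIV ?L \<mu>" using caratheodory_lemma[OF oms] .
  then have "positive ?L \<mu>" "countably_additive ?L \<mu>" by (auto simp: measure_space_def)
  then have *: "positive (sets borel) \<mu>" "countably_additive (sets borel) \<mu>"
    unfolding positive_def countably_additive_def using sub by (blast, meson subset_eq)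
  let ?\<nu> = "measure_of UNIV (sets borel) \<mu>"
  have s: "sets ?\<nu> = sets borel"
    using sets.sigma_sets_eq[of "borel :: 'a measure"] by simp
  moreover have "emeasure ?\<nu> A = \<mu> A" if "A \<in> sets borel" for A
    by (rule emeasure_measure_of[OF refl]) (use * s that in auto)
  ultimately show ?thesis using that by blast
qed

text \<open>What \<open>Q_regular\<close> gives for a compact set, with a Borel measure in place of
  the outer measure. A positive diameter keeps the ball bounds from being vacuous.\<close>

locale regular_measure =
  fixes \<nu> :: "'a::euclidean_space measure" and E :: "'a set" and Q \<alpha> \<beta> :: real
  assumes compact_E: "compact E" and diameter_pos: "0 < diameter E"
    and sets_eq: "sets \<nu> = sets borel" and null_Compl: "emeasure \<nu> (- E) = 0"
    and Q_pos: "0 < Q" and Q_less: "Q < DIM('a)" and \<alpha>_pos: "0 < \<alpha>" and \<alpha>_le: "\<alpha> \<le> \<beta>"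
    and lower: "\<And>x r. \<lbrakk>x \<in> E; 0 < r; r < diameter E\<rbrakk> \<Longrightarrow> ennreal (\<alpha> * r powr Q) \<le> emeasure \<nu> (ball x r)"
    and upper: "\<And>x r. \<lbrakk>x \<in> E; 0 < r; r < diameter E\<rbrakk> \<Longrightarrow> emeasure \<nu> (ball x r) \<le> ennreal (\<beta> * r powr Q)"
begin

lemma E_nonempty: "E \<noteq> {}"
  using diameter_pos by auto

lemma \<beta>_pos: "0 < \<beta>"
  using \<alpha>_pos \<alpha>_le by linarith

text \<open>The covering balls carry all the mass, and each has mass at most
  \<open>\<beta> * \<rho> powr Q\<close>.\<close>

lemma card_covering_ge:
  assumes S: "finite S" "S \<subseteq> E" "E \<subseteq> (\<Union>x\<in>S. ball x \<rho>)" and \<rho>: "0 < \<rho>" "\<rho> < diameter E"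
  shows "\<alpha> * (diameter E / 2) powr Q \<le> card S * (\<beta> * \<rho> powr Q)"
proof -
  obtain e where e: "e \<in> E" using E_nonempty by blast
  have [measurable]: "E \<in> sets \<nu>" "- E \<in> sets \<nu>" "\<And>x r. ball x r \<in> sets \<nu>"
    using compact_E by (auto simp: sets_eq compact_imp_closed)
  \<comment> \<open>Half the diameter is used because the bounds require radii strictly below the
    diameter. The ball may leave the cover outside \<open>E\<close>; joining the null set
    \<open>- E\<close> repairs the inclusion.\<close>
  have "ennreal (\<alpha> * (diameter E / 2) powr Q) \<le> emeasure \<nu> (ball e (diameter E / 2))"
    using lower[OF e] diameter_pos by simp
  also have "\<dots> \<le> emeasure \<nu> (- E \<union> (\<Union>x\<in>S. ball x \<rho>))"
    using S by (intro emeasure_mono sets.Un sets.finite_UN) auto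
  also have "\<dots> \<le> emeasure \<nu> (- E) + emeasure \<nu> (\<Union>x\<in>S. ball x \<rho>)"
    using S by (intro emeasure_subadditive) auto
  also have "\<dots> = emeasure \<nu> (\<Union>x\<in>S. ball x \<rho>)"
    by (simp add: null_Compl)
  also have "\<dots> \<le> (\<Sum>x\<in>S. emeasure \<nu> (ball x \<rho>))"
    using S by (intro emeasure_subadditive_finite) auto
  also have "\<dots> \<le> (\<Sum>x\<in>S. ennreal (\<beta> * \<rho> powr Q))"
    using S \<rho> by (intro sum_mono upper) auto
  also have "\<dots> = ennreal (card S * (\<beta> * \<rho> powr Q))"
    using \<beta>_pos by (simp add: ennreal_mult ennreal_of_nat_eq_real_of_nat)
  finally show ?thesis
    using \<beta>_pos by (subst (asm) ennreal_le_iff) auto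
qed

text \<open>Disjoint balls inside \<open>ball a R\<close> share its mass, and each takes at least
  \<open>\<alpha> * \<rho> powr Q\<close> of it.\<close>

lemma card_packing_le:
  assumes S: "finite S" "S \<subseteq> E" "disjoint_family_on (\<lambda>x. ball x \<rho>) S"
    and sub: "\<And>x. x \<in> S \<Longrightarrow> ball x \<rho> \<subseteq> ball a R"
    and \<rho>: "0 < \<rho>" "\<rho> < diameter E" and R: "a \<in> E" "0 < R" "R < diameter E"
  shows "card S * (\<alpha> * \<rho> powr Q) \<le> \<beta> * R powr Q"
proof -
  have [measurable]: "\<And>x r. ball x r \<in> sets \<nu>" by (simp add: sets_eq)
  have "ennreal (card S * (\<alpha> * \<rho> powr Q)) = (\<Sum>x\<in>S. ennreal (\<alpha> * \<rho> powr Q))"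
    using \<alpha>_pos by (simp add: ennreal_mult ennreal_of_nat_eq_real_of_nat)
  also have "\<dots> \<le> (\<Sum>x\<in>S. emeasure \<nu> (ball x \<rho>))"
    using S \<rho> by (intro sum_mono lower) auto
  also have "\<dots> = emeasure \<nu> (\<Union>x\<in>S. ball x \<rho>)"
    using S by (intro sum_emeasure) auto
  also have "\<dots> \<le> emeasure \<nu> (ball a R)"
    using sub by (intro emeasure_mono) auto
  also have "\<dots> \<le> ennreal (\<beta> * R powr Q)"
    using R by (intro upper)
  finally show ?thesis
    using \<beta>_pos by (subst (asm) ennreal_le_iff) auto
qed

text \<open>Otherwise the balls of radius \<open>4s\<close> about a \<open>2s\<close>-net of \<open>E\<close> cover \<open>ball a (lam * s)\<close>, so
  the net has at least \<open>(lam / 4)^n\<close> points, whereas regularity allows only about \<open>lam^Q\<close>.\<close>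

lemma porous:
  assumes lam: "4 \<le> lam" "\<beta> / \<alpha> * (2 * lam) powr Q * 4 ^ DIM('a) < lam ^ DIM('a)"
    and s: "0 < s" "2 * lam * s < diameter E" and a: "a \<in> E"
  shows "\<exists>z\<in>ball a (lam * s). 2 * s < infdist z E"
proof (rule ccontr)
  assume "\<not> ?thesis"
  then have near: "infdist z E \<le> 2 * s" if "dist a z < lam * s" for z
    using that by force
  have lams: "4 * s \<le> lam * s" using lam s by simp
  \<comment> \<open>Points of \<open>E\<close> nearest to points of \<open>ball a (lam * s)\<close>
    lie in \<open>F\<close>, so a net of \<open>F\<close> suffices and stays near
    \<open>a\<close>.\<close>
  define F where "F = E \<inter> cball a (lam * s + 2 * s)"
  have "compact F" "0 < 2 * s"
    unfolding F_def using compact_E s(1) by (auto simp: compact_Int_closed)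
  then obtain T where T: "finite T" "T \<subseteq> F"
    "pairwise (\<lambda>x y. 2 * s \<le> dist x y) T" "F \<subseteq> (\<Union>x\<in>T. ball x (2 * s))"
    by (rule compact_separated_net)
  have cov: "ball a (lam * s) \<subseteq> (\<Union>y\<in>T. ball y (4 * s))"
  proof
    fix p assume p: "p \<in> ball a (lam * s)"
    obtain e where e: "e \<in> E" "infdist p E = dist p e"
      using infdist_attains_inf[OF compact_imp_closed[OF compact_E] E_nonempty] by blast
    have pe: "dist p e \<le> 2 * s" using near[of p] p e by simp
    then have "e \<in> F" using p e dist_triangle[of a e p] by (simp add: F_def)
    then obtain y where y: "y \<in> T" "dist y e < 2 * s" using T(4) by auto
    then have "dist y p < 4 * s" using pe dist_triangle2[of y p e] by simp
    then show "p \<in> (\<Union>y\<in>T. ball y (4 * s))" using y by auto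
  qed
  let ?w = "unit_ball_vol (DIM('a))" and ?n = "DIM('a)"
  have w: "0 < ?w" by simp
  have "ennreal (?w * (lam * s) ^ ?n) = emeasure lborel (ball a (lam * s))"
    using lam s by (simp add: emeasure_ball)
  also have "\<dots> \<le> emeasure lborel (\<Union>y\<in>T. ball y (4 * s))"
    using cov by (intro emeasure_mono) (simp_all add: borel_open open_UN)
  also have "\<dots> \<le> (\<Sum>y\<in>T. emeasure lborel (ball y (4 * s)))"
    using T(1) by (intro emeasure_subadditive_finite) auto
  also have "\<dots> = ennreal (card T * (?w * (4 * s) ^ ?n))"
    using s(1) by (simp add: emeasure_ball ennreal_mult ennreal_of_nat_eq_real_of_nat)
  finally have "?w * (lam * s) ^ ?n \<le> card T * (?w * (4 * s) ^ ?n)"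
    using s(1) by (subst (asm) ennreal_le_iff) auto
  then have "(?w * s ^ ?n) * lam ^ ?n \<le> (?w * s ^ ?n) * (real (card T) * 4 ^ ?n)"
    by (simp add: power_mult_distrib mult_ac)
  then have vol: "lam ^ ?n \<le> real (card T) * 4 ^ ?n"
    using w s(1) by (subst (asm) mult_le_cancel_left_pos) auto
  \<comment> \<open>Separation by \<open>2 * s\<close> makes the balls of radius \<open>s\<close>
    disjoint; they fit into the larger ball since
    \<open>lam * s + 3 * s \<le> 2 * lam * s\<close>.\<close>
  have "card T * (\<alpha> * s powr Q) \<le> \<beta> * (2 * lam * s) powr Q"
  proof (rule card_packing_le[OF T(1) _ disjoint_family_on_separated_balls[OF T(3)]])
    show "ball x s \<subseteq> ball a (2 * lam * s)" if "x \<in> T" for x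
    proof
      fix p assume "p \<in> ball x s"
      moreover have "dist a x \<le> lam * s + 2 * s" using that T(2) by (auto simp: F_def)
      ultimately show "p \<in> ball a (2 * lam * s)"
        using dist_triangle[of a p x] lams s(1) unfolding mem_ball by linarith
    qed
    show "s < diameter E" "0 < 2 * lam * s" using lams s by linarith+
  qed (use T F_def s a in auto)
  then have "s powr Q * (\<alpha> * card T) \<le> s powr Q * (\<beta> * (2 * lam) powr Q)"
    using s(1) lam(1) by (simp add: powr_mult mult_ac)
  then have "\<alpha> * card T \<le> \<beta> * (2 * lam) powr Q"
    using s(1) by (subst (asm) mult_le_cancel_left_pos) auto
  then have "card T \<le> \<beta> / \<alpha> * (2 * lam) powr Q"
    using \<alpha>_pos by (simp add: field_simps)
  then have "real (card T) * 4 ^ ?n \<le> \<beta> / \<alpha> * (2 * lam) powr Q * 4 ^ ?n"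
    by (intro mult_right_mono) auto
  then show False using vol lam(2) by linarith
qed

text \<open>Porosity puts a ball of radius \<open>s\<close> in the layer near each point of a
  \<open>4 * lam * s\<close>-separated net of \<open>E\<close>. These balls are disjoint, and the
  covering count bounds their number below.\<close>

lemma layer_volume:
  assumes lam: "4 \<le> lam" "\<beta> / \<alpha> * (2 * lam) powr Q * 4 ^ DIM('a) < lam ^ DIM('a)"
    and s: "0 < s" "4 * lam * s < diameter E"
  obtains B where "B \<in> sets borel" "\<And>z. z \<in> B \<Longrightarrow> s < infdist z E \<and> infdist z E < 2 * lam * s"
    "ennreal (\<alpha> / \<beta> * (diameter E / (8 * lam * s)) powr Q * (unit_ball_vol DIM('a) * s ^ DIM('a)))
      \<le> emeasure lborel B"
proof -
  let ?w = "unit_ball_vol (DIM('a))" and ?n = "DIM('a)"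
  have lams: "4 * s \<le> lam * s" using lam s by simp
  have "0 < 2 * (2 * lam * s)" using lam s by simp
  with compact_E obtain S where S: "finite S" "S \<subseteq> E"
    "pairwise (\<lambda>x y. 2 * (2 * lam * s) \<le> dist x y) S"
    "E \<subseteq> (\<Union>x\<in>S. ball x (2 * (2 * lam * s)))"
    by (rule compact_separated_net)
  \<comment> \<open>The margin \<open>2 * s\<close> keeps a whole ball of radius \<open>s\<close>
    about the centre farther than \<open>s\<close> from \<open>E\<close>.\<close>
  have "\<forall>x\<in>S. \<exists>z\<in>ball x (lam * s). 2 * s < infdist z E"
    using porous[OF lam s(1)] s lams S(2) by auto
  then obtain f where f: "\<And>x. x \<in> S \<Longrightarrow> dist x (f x) < lam * s \<and> 2 * s < infdist (f x) E"
    by (metis mem_ball)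
  \<comment> \<open>Used twice: for disjointness of the small balls and for the upper bound on the
    distance to \<open>E\<close>.\<close>
  have sub: "ball (f x) s \<subseteq> ball x (2 * lam * s)" if "x \<in> S" for x
  proof
    fix p assume "p \<in> ball (f x) s"
    then show "p \<in> ball x (2 * lam * s)"
      using f[OF that] dist_triangle[of x p "f x"] lams s(1) unfolding mem_ball by linarith
  qed
  define B where "B = (\<Union>x\<in>S. ball (f x) s)"
  have "disjoint_family_on (\<lambda>x. ball x (2 * lam * s)) S"
    by (rule disjoint_family_on_separated_balls[OF S(3)])
  then have disj: "disjoint_family_on (\<lambda>x. ball (f x) s) S"
    using sub unfolding disjoint_family_on_def by blast
  define P where "P = (4 * lam * s) powr Q"
  have P: "0 < P" using s lam by (simp add: P_def)
  have "\<alpha> * (diameter E / 2) powr Q \<le> card S * (\<beta> * P)"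
    using card_covering_ge[OF S(1,2,4)] s lams by (simp add: mult.assoc P_def)
  then have "\<alpha> * (diameter E / 2) powr Q / (\<beta> * P) \<le> card S"
    using P \<beta>_pos by (simp add: pos_divide_le_eq)
  moreover have "(diameter E / (8 * lam * s)) powr Q = (diameter E / 2) powr Q / P"
    unfolding P_def using s lams diameter_pos by (subst powr_divide[symmetric]) (auto simp: mult.assoc)
  ultimately have card: "\<alpha> / \<beta> * (diameter E / (8 * lam * s)) powr Q \<le> card S"
    by simp
  have "ennreal (\<alpha> / \<beta> * (diameter E / (8 * lam * s)) powr Q * (?w * s ^ ?n))
      \<le> ennreal (card S * (?w * s ^ ?n))"
    using s(1) by (intro ennreal_leI mult_right_mono[OF card]) auto
  also have "\<dots> = (\<Sum>x\<in>S. emeasure lborel (ball (f x) s))"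
    using s(1) by (simp add: emeasure_ball ennreal_mult ennreal_of_nat_eq_real_of_nat)
  also have "\<dots> = emeasure lborel B"
    unfolding B_def using S(1) disj by (intro sum_emeasure) auto
  finally have *: "ennreal (\<alpha> / \<beta> * (diameter E / (8 * lam * s)) powr Q * (?w * s ^ ?n))
      \<le> emeasure lborel B" .
  have "s < infdist z E \<and> infdist z E < 2 * lam * s" if "z \<in> B" for z
  proof -
    from that obtain x where x: "x \<in> S" "dist (f x) z < s" by (auto simp: B_def)
    then have "s < infdist z E"
      using f[OF x(1)] infdist_triangle[of "f x" E z] by simp
    moreover have "dist x z < 2 * lam * s" using sub[OF x(1)] x(2) by (simp add: subset_iff)
    then have "infdist z E < 2 * lam * s"
      using infdist_le[of x E z] x S(2) by (force simp: dist_commute)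
    ultimately show ?thesis ..
  qed
  moreover have "B \<in> sets borel" unfolding B_def by (intro borel_open open_UN) auto
  ultimately show ?thesis using that * by blast
qed

end

lemma Q_regularE:
  assumes "compact E" "0 < diameter E" "Q_regular Q \<alpha> \<beta> E"
  obtains \<nu> where "regular_measure \<nu> E Q \<alpha> \<beta>"
proof -
  from assms(3) obtain \<mu> where const: "0 < Q" "Q < DIM('a)" "0 < \<alpha>" "\<alpha> \<le> \<beta>"
    and \<mu>: "borel_regular_outer_measure \<mu>" "measure_support \<mu> E"
    and bounds: "\<And>x r. \<lbrakk>x \<in> E; 0 < r; r < diameter E\<rbrakk> \<Longrightarrow>
        ennreal (\<alpha> * r powr Q) \<le> \<mu> (ball x r) \<and> \<mu> (ball x r) \<le> ennreal (\<beta> * r powr Q)"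
    unfolding Q_regular_def by blast
  obtain \<nu> where \<nu>: "sets \<nu> = sets borel" "\<And>A. A \<in> sets borel \<Longrightarrow> emeasure \<nu> A = \<mu> A"
    using borel_measure_of_outer_measure[OF \<mu>(1)] by blast
  have "- E \<in> sets borel" using compact_imp_closed[OF assms(1)] by auto
  then have "regular_measure \<nu> E Q \<alpha> \<beta>"
    using assms const bounds \<nu> \<mu>(2) by unfold_locales (auto simp: measure_support_def)
  then show ?thesis using that by blast
qed

section \<open>Porosity constant, gauge inversion and volume near the centre\<close>

text \<open>Supplies the \<open>lam\<close> of \<open>porous\<close>: since \<open>Q < n\<close>,
  the power \<open>lam ^ n\<close> eventually dominates any multiple of
  \<open>lam powr Q\<close>.\<close>

lemma powr_growth_witness:
  fixes Q K :: real
  assumes "Q < real n"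
  obtains lam :: real where "4 \<le> lam" "K * (2 * lam) powr Q < lam ^ n"
proof -
  define p where "p = n - Q"
  \<comment> \<open>Chosen so that \<open>l powr p\<close> exceeds \<open>K * 2 powr Q\<close>; the
    absolute value covers negative \<open>K\<close>.\<close>
  define l where "l = max 4 ((\<bar>K\<bar> * 2 powr Q + 1) powr (1 / p))"
  have p: "0 < p" using assms by (simp add: p_def)
  have l4: "4 \<le> l" by (simp add: l_def)
  have "K * 2 powr Q < \<bar>K\<bar> * 2 powr Q + 1"
    by (smt (verit) mult_right_mono powr_ge_zero)
  also have "\<dots> = ((\<bar>K\<bar> * 2 powr Q + 1) powr (1 / p)) powr p"
    using p by (simp add: powr_powr add_nonneg_pos)
  also have "\<dots> \<le> l powr p"
    using p by (intro powr_mono2) (auto simp: l_def)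
  finally have l: "4 \<le> l" "K * 2 powr Q < l powr (n - Q)"
    using l4 by (simp_all add: p_def)
  have "K * (2 * l) powr Q = K * 2 powr Q * l powr Q"
    using l by (simp add: powr_mult)
  also have "\<dots> < l powr (n - Q) * l powr Q"
    using l by (intro mult_strict_right_mono) auto
  also have "\<dots> = l ^ n"
    using l by (simp add: powr_add[symmetric] powr_realpow)
  finally show ?thesis using that l by blast
qed

text \<open>Stands in for monotonicity of \<open>\<psi>\<close>: if
  \<open>\<psi> \<tau> \<ge> r\<close>, the intermediate value theorem gives
  \<open>\<sigma> \<le> \<tau>\<close> with \<open>\<psi> \<sigma> = r\<close>, that is
  \<open>\<sigma> = \<psi>inv r\<close>.\<close>

lemma psi_less:
  fixes \<psi> :: "real \<Rightarrow> real"
  assumes hom: "homeomorphism {0..} {0..} \<psi> \<psi>inv" and "\<psi> 0 = 0"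
    and "0 < r" "0 \<le> \<tau>" "\<tau> < \<psi>inv r"
  shows "\<psi> \<tau> < r"
proof (rule ccontr)
  assume "\<not> \<psi> \<tau> < r"
  moreover have "continuous_on {0..\<tau>} \<psi>"
    using homeomorphism_cont1[OF hom] by (rule continuous_on_subset) auto
  ultimately obtain \<sigma> where "0 \<le> \<sigma>" "\<sigma> \<le> \<tau>" "\<psi> \<sigma> = r"
    using IVT'[of \<psi> 0 r \<tau>] assms by auto
  then show False using homeomorphism_apply1[OF hom, of \<sigma>] assms(5) by simp
qed

lemma ball_bdist_subset:
  fixes G :: "'a::euclidean_space set"
  assumes "x \<in> G"
  shows "ball x (bdist G x) \<subseteq> G"
proof (rule ccontr)
  assume "\<not> ?thesis"
  then obtain w where w: "dist x w < bdist G x" "w \<notin> G"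
    unfolding subset_iff mem_ball by blast
  have "closed_segment x w \<inter> frontier G \<noteq> {}"
    using assms w(2) by (intro connected_Int_frontier) auto
  then obtain p where p: "p \<in> closed_segment x w" "p \<in> frontier G" by blast
  have "bdist G x \<le> dist x p" unfolding bdist_def using p(2) by (rule infdist_le)
  then show False using dist_in_closed_segment[OF p(1)] w(1) by (simp add: dist_commute)
qed

text \<open>On the Euclidean ball of radius \<open>\<delta> / 2\<close> the boundary distance lies
  between \<open>\<delta> / 2\<close> and \<open>3 * \<delta> / 2\<close>. Hence its points have
  quasihyperbolic distance below 1 from \<open>x\<close>, and \<open>\<delta>\<close> cancels from
  the volume bound.\<close>

lemma qh_vol_ball_ge:
  fixes G :: "'a::euclidean_space set"
  assumes x: "x \<in> G" and pos: "0 < bdist G x" and r: "1 \<le> r"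
  shows "ennreal (unit_ball_vol DIM('a) / 3 ^ DIM('a)) \<le> qh_vol G (qh_ball G x r)"
proof -
  define \<delta> where "\<delta> = bdist G x"
  have \<delta>: "0 < \<delta>" using pos by (simp add: \<delta>_def)
  let ?B = "ball x (\<delta> / 2)" and ?n = "DIM('a)"
  have bnd: "\<delta> / 2 \<le> bdist G z \<and> bdist G z \<le> 3 * \<delta> / 2" if "z \<in> ?B" for z
    using infdist_triangle_abs[of x "frontier G" z] that unfolding \<delta>_def bdist_def by auto
  have BG: "?B \<subseteq> G"
    using ball_bdist_subset[OF x] \<delta> by (force simp: \<delta>_def)
  have sub: "?B \<subseteq> qh_ball G x r"
  proof
    fix z assume z: "z \<in> ?B"
    have seg: "closed_segment x z \<subseteq> ?B"
      using z \<delta> by (intro closed_segment_subset) auto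
    have "qh_dist G x z \<le> ennreal (dist x z / (\<delta> / 2))"
      using seg BG bnd \<delta> by (intro qh_dist_le_segment) auto
    also have "\<dots> < ennreal r"
    proof (intro ennreal_lessI)
      have "dist x z / (\<delta> / 2) < 1" using z \<delta> by (simp add: divide_simps)
      then show "dist x z / (\<delta> / 2) < r" using r by linarith
    qed (use r in auto)
    finally show "z \<in> qh_ball G x r" using z BG by (auto simp: qh_ball_def)
  qed
  have "unit_ball_vol ?n / 3 ^ ?n = 1 / (3 * \<delta> / 2) ^ ?n * (unit_ball_vol ?n * (\<delta> / 2) ^ ?n)"
    using \<delta> by (simp add: power_divide power_mult_distrib)
  then have "ennreal (unit_ball_vol ?n / 3 ^ ?n)
      = ennreal (1 / (3 * \<delta> / 2) ^ ?n) * emeasure lborel ?B"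
    using \<delta> by (simp only: emeasure_ball) (simp add: ennreal_mult[symmetric])
  also have "\<dots> \<le> qh_vol G (qh_ball G x r)"
    using bnd \<delta> by (intro qh_vol_ge sub) (auto intro: less_le_trans[of 0 "\<delta> / 2"])
  finally show ?thesis .
qed

section \<open>Volume of the layer and the final estimate\<close>

context regular_measure
begin

text \<open>With \<open>t = \<psi>inv r\<close>, the layer of points at distance between \<open>M / t\<close> and
  \<open>2 * lam * M / t\<close> from \<open>E\<close> lies in the quasihyperbolic ball of radius \<open>r\<close>.\<close>

lemma qh_vol_ge_of_large:
  assumes lam: "4 \<le> lam" "\<beta> / \<alpha> * (2 * lam) powr Q * 4 ^ DIM('a) < lam ^ DIM('a)"
    and hom: "homeomorphism {0..} {0..} \<psi> \<psi>inv" "\<psi> 0 = 0" and uniform: "psi_uniform \<psi> (- E)"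
    and x: "x \<in> - E" "bdist (- E) x = \<delta>" and \<delta>: "0 < \<delta>" and r: "0 < r"
    and M: "M = 2 * \<delta> + diameter E"
    and large: "2 * lam * M / \<delta> + 4 * lam * M / diameter E < \<psi>inv r"
  shows "ennreal (\<alpha> / \<beta> * (diameter E / (8 * lam * M)) powr Q * unit_ball_vol DIM('a)
      / (2 * lam) ^ DIM('a) * \<psi>inv r powr Q) \<le> qh_vol (- E) (qh_ball (- E) x r)"
proof -
  let ?n = "DIM('a)"
  define t where "t = \<psi>inv r"
  \<comment> \<open>With \<open>dist x z < M\<close> and \<open>infdist z E > s\<close> on the
    layer, the argument of \<open>\<psi>\<close> stays below
    \<open>M / s = \<psi>inv r\<close>.\<close>
  define s where "s = M / t"
  have Mpos: "0 < M" using M \<delta> diameter_pos by linarith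
  have parts: "0 < 2 * lam * M / \<delta>" "0 < 4 * lam * M / diameter E"
    using lam \<delta> Mpos diameter_pos by simp_all
  \<comment> \<open>The first bound will make layer points closer to \<open>E\<close> than
    \<open>x\<close>, so the minimum in \<open>psi_uniform\<close> is taken at \<open>z\<close>; the
    second meets the scale condition of \<open>layer_volume\<close>.\<close>
  then have "0 < t" "2 * lam * M / \<delta> < t" "4 * lam * M / diameter E < t"
    using large unfolding t_def by linarith+
  then have t: "0 < t" and s: "0 < s" "2 * lam * s < \<delta>" "4 * lam * s < diameter E"
    using \<delta> diameter_pos Mpos by (auto simp: s_def field_simps)
  obtain B where B: "B \<in> sets borel"
    "\<And>z. z \<in> B \<Longrightarrow> s < infdist z E \<and> infdist z E < 2 * lam * s"
    "ennreal (\<alpha> / \<beta> * (diameter E / (8 * lam * s)) powr Q * (unit_ball_vol ?n * s ^ ?n))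
      \<le> emeasure lborel B"
    using layer_volume[OF lam s(1,3)] by blast
  have closed: "closed E" using compact_E by (rule compact_imp_closed)
  have outside: "z \<notin> E \<and> bdist (- E) z = infdist z E" if "z \<in> B" for z
  proof -
    have "z \<notin> E" using B(2)[OF that] s(1) by auto
    then show ?thesis using bdist_Compl_eq_infdist[OF closed E_nonempty] by blast
  qed
  have x_inf: "infdist x E = \<delta>" using bdist_Compl_eq_infdist[OF closed E_nonempty] x by auto
  have sub: "B \<subseteq> qh_ball (- E) x r"
  proof
    fix z assume z: "z \<in> B"
    obtain e where e: "e \<in> E" "infdist x E = dist x e"
      using infdist_attains_inf[OF closed E_nonempty] by blast
    obtain f where f: "f \<in> E" "infdist z E = dist z f"
      using infdist_attains_inf[OF closed E_nonempty] by blast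
    \<comment> \<open>Going from \<open>x\<close> to \<open>E\<close>, across \<open>E\<close> and
      out to \<open>z\<close> costs less than
      \<open>\<delta> + diameter E + 2 * lam * s < M\<close>.\<close>
    have "dist e f \<le> diameter E"
      using diameter_bounded_bound[OF compact_imp_bounded[OF compact_E] e(1) f(1)] .
    moreover have "dist x z \<le> dist x e + dist e f + dist z f"
      using dist_triangle[of x z e] dist_triangle2[of e z f] by linarith
    ultimately have xz: "dist x z < M"
      using e f x_inf B(2)[OF z] s M by linarith
    let ?\<tau> = "dist x z / min (bdist (- E) x) (bdist (- E) z)"
    have "min (bdist (- E) x) (bdist (- E) z) = infdist z E"
      using outside[OF z] x(2) B(2)[OF z] s by simp
    moreover have "dist x z / infdist z E < M / s"
      using xz B(2)[OF z] s(1) Mpos by (intro frac_less) auto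
    moreover have "M / s = t" using Mpos t by (simp add: s_def)
    ultimately have \<tau>: "0 \<le> ?\<tau>" "?\<tau> < \<psi>inv r" by (auto simp: t_def infdist_nonneg)
    have "qh_dist (- E) x z \<le> ennreal (\<psi> ?\<tau>)"
      using uniform x(1) outside[OF z] unfolding psi_uniform_def by blast
    also have "\<dots> < ennreal r"
      using psi_less[OF hom r \<tau>] r by (intro ennreal_lessI)
    finally show "z \<in> qh_ball (- E) x r" using outside[OF z] by (simp add: qh_ball_def)
  qed
  have "diameter E / (8 * lam * s) = diameter E / (8 * lam * M) * t"
    using t by (simp add: s_def)
  then have p: "(diameter E / (8 * lam * s)) powr Q = (diameter E / (8 * lam * M)) powr Q * t powr Q"
    using t lam Mpos diameter_pos by (simp only: powr_mult)
  \<comment> \<open>The density bound cancels \<open>s ^ ?n\<close> from the ball volume, leaving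
    only the power \<open>t powr Q\<close>.\<close>
  have "\<alpha> / \<beta> * (diameter E / (8 * lam * M)) powr Q * unit_ball_vol ?n / (2 * lam) ^ ?n * t powr Q
      = 1 / (2 * lam * s) ^ ?n *
        (\<alpha> / \<beta> * (diameter E / (8 * lam * s)) powr Q * (unit_ball_vol ?n * s ^ ?n))"
    unfolding p using s(1) by (simp add: power_mult_distrib mult_ac)
  then have "ennreal (\<alpha> / \<beta> * (diameter E / (8 * lam * M)) powr Q * unit_ball_vol ?n
        / (2 * lam) ^ ?n * t powr Q)
      = ennreal (1 / (2 * lam * s) ^ ?n) *
        ennreal (\<alpha> / \<beta> * (diameter E / (8 * lam * s)) powr Q * (unit_ball_vol ?n * s ^ ?n))"
    using s(1) lam(1) by (subst ennreal_mult'[symmetric]) simp_all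
  also have "\<dots> \<le> ennreal (1 / (2 * lam * s) ^ ?n) * emeasure lborel B"
    by (intro mult_left_mono B(3)) simp
  also have "\<dots> \<le> qh_vol (- E) (qh_ball (- E) x r)"
    using B(2) outside s(1) by (intro qh_vol_ge B(1) sub) fastforce
  finally show ?thesis unfolding t_def .
qed

end

text \<open>Choosing \<open>c\<close> and \<open>r\<^sub>1\<close> before \<open>E\<close>,
  \<open>\<psi>\<close> and \<open>x\<close> expresses that they depend only on the dimension,
  \<open>Q\<close>, \<open>\<alpha>\<close>, \<open>\<beta>\<close>, the diameter \<open>D\<close>
  and the distance \<open>\<delta>\<close>.\<close>

theorem theorem5p6:
  fixes Q \<alpha> \<beta> D \<delta> :: real
  assumes "2 \<le> CARD('n::finite)"
    and "0 < D"
  shows "\<exists>c>0. \<exists>r\<^sub>1>0. \<forall>(E :: (real^'n) set) (\<psi> :: real \<Rightarrow> real) (\<psi>inv :: real \<Rightarrow> real) (x :: real^'n).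
           compact E \<and> Q_regular Q \<alpha> \<beta> E \<and> diameter E = D \<and>
           homeomorphism {0..} {0..} \<psi> \<psi>inv \<and> \<psi> 0 = 0 \<and>
           psi_uniform \<psi> (- E) \<and> x \<in> - E \<and> bdist (- E) x = \<delta>
           \<longrightarrow> (\<forall>r>r\<^sub>1. ennreal (c * (\<psi>inv r) powr Q) \<le> qh_vol (- E) (qh_ball (- E) x r))"
proof (cases "0 < Q \<and> Q < DIM(real^'n) \<and> 0 < \<alpha> \<and> \<alpha> \<le> \<beta> \<and> 0 < \<delta>")
  case False
  \<comment> \<open>For parameters out of range the hypotheses are contradictory, so any positive
    constants do.\<close>
  have "\<not> (compact E \<and> Q_regular Q \<alpha> \<beta> E \<and> diameter E = D \<and> x \<in> - E \<and> bdist (- E) x = \<delta>)"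
    for E :: "(real^'n) set" and x
  proof
    assume H: "compact E \<and> Q_regular Q \<alpha> \<beta> E \<and> diameter E = D \<and> x \<in> - E \<and> bdist (- E) x = \<delta>"
    then have "closed E" "E \<noteq> {}" "x \<notin> E" using assms(2) by (auto simp: compact_imp_closed)
    then have "0 < \<delta>"
      using H infdist_pos_not_in_closed[of E x] bdist_Compl_eq_infdist[of E x] by simp
    then show False using H False by (auto simp: Q_regular_def)
  qed
  then show ?thesis by (intro exI[of _ 1] conjI zero_less_one) blast
next
  case True
  let ?n = "DIM(real^'n)"
  let ?w = "unit_ball_vol ?n"
  obtain lam where lam: "4 \<le> lam" "\<beta> / \<alpha> * 4 ^ ?n * (2 * lam) powr Q < lam ^ ?n"
    using powr_growth_witness True by blast
  define M where "M = 2 * \<delta> + D"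
  define C where "C = 2 * lam * M / \<delta> + 4 * lam * M / D"
  \<comment> \<open>\<open>C\<close> is the threshold of \<open>qh_vol_ge_of_large\<close>. Below it
    \<open>c\<^sub>0 * C powr Q\<close> is exactly the volume bound near \<open>x\<close>; above it
    \<open>c\<^sub>1\<close> comes from the layer.\<close>
  define c\<^sub>0 where "c\<^sub>0 = ?w / 3 ^ ?n / C powr Q"
  define c\<^sub>1 where "c\<^sub>1 = \<alpha> / \<beta> * (D / (8 * lam * M)) powr Q * ?w / (2 * lam) ^ ?n"
  have M: "0 < M" using True assms(2) by (simp add: M_def)
  have C: "0 < C" using M lam True assms(2) by (simp add: C_def add_pos_pos)
  have c: "0 < c\<^sub>0" "0 < c\<^sub>1" using C M lam True assms(2) by (simp_all add: c\<^sub>0_def c\<^sub>1_def)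
  have "ennreal (min c\<^sub>0 c\<^sub>1 * \<psi>inv r powr Q) \<le> qh_vol (- E) (qh_ball (- E) x r)"
    if E: "compact E" "Q_regular Q \<alpha> \<beta> E" "diameter E = D"
      and \<psi>: "homeomorphism {0..} {0..} \<psi> \<psi>inv" "\<psi> 0 = 0" "psi_uniform \<psi> (- E)"
      and x: "x \<in> - E" "bdist (- E) x = \<delta>" and r: "1 < r"
    for E :: "(real^'n) set" and \<psi> \<psi>inv x r
  proof (cases "\<psi>inv r \<le> C")
    case small: True
    have "0 \<le> \<psi>inv r" using homeomorphism_image2[OF \<psi>(1)] r by force
    then have "min c\<^sub>0 c\<^sub>1 * \<psi>inv r powr Q \<le> c\<^sub>0 * C powr Q"
      using small True c by (intro mult_mono powr_mono2) auto
    also have "\<dots> = ?w / 3 ^ ?n" using C by (simp add: c\<^sub>0_def)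
    finally have "ennreal (min c\<^sub>0 c\<^sub>1 * \<psi>inv r powr Q) \<le> ennreal (?w / 3 ^ ?n)"
      by (rule ennreal_leI)
    also have "\<dots> \<le> qh_vol (- E) (qh_ball (- E) x r)"
      using x True r by (intro qh_vol_ball_ge) auto
    finally show ?thesis .
  next
    case False
    obtain \<nu> where "regular_measure \<nu> E Q \<alpha> \<beta>"
      using Q_regularE[OF E(1) _ E(2)] E(3) assms(2) by blast
    then interpret regular_measure \<nu> E Q \<alpha> \<beta> .
    have "\<beta> / \<alpha> * (2 * lam) powr Q * 4 ^ ?n < lam ^ ?n"
      using lam(2) by (simp add: mult_ac)
    then have "ennreal (c\<^sub>1 * \<psi>inv r powr Q) \<le> qh_vol (- E) (qh_ball (- E) x r)"
      unfolding c\<^sub>1_def E(3)[symmetric] using False True r x \<psi> E(3)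
      by (intro qh_vol_ge_of_large[OF lam(1)]) (auto simp: C_def M_def)
    moreover have "min c\<^sub>0 c\<^sub>1 * \<psi>inv r powr Q \<le> c\<^sub>1 * \<psi>inv r powr Q"
      by (intro mult_right_mono) auto
    ultimately show ?thesis using ennreal_leI order_trans by blast
  qed
  then show ?thesis
    using c by (intro exI[of _ "min c\<^sub>0 c\<^sub>1"] exI[of _ 1] conjI) auto
qed

end
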